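(* For every $n \in \mathbb{N} = \{1,2,3,\dots\}$ and every union-closed family $\mathcal{F}$ with $|\bigcup \mathcal{F}| = n$, \[ D(\mathcal{F}) \geq \frac{\log_2 n}{2n}. \] Equivalently, $s_n \geq \frac{\log_2 n}{2n}$ for all $n \in \mathbb{N}$.
   Context: A union-closed family is a finite family $\mathcal{F}$ of finite sets such that $A \cup B \in \mathcal{F}$ for all $A, B \in \mathcal{F}$. Write $\bigcup \mathcal{F} := \bigcup_{A \in \mathcal{F}} A$ and, for $a \in \bigcup \mathcal{F}$, $\mathcal{F}_a := \{S \in \mathcal{F} : a \in S\}$. For a union-closed family with $n = |\bigcup\mathcal{F}| \geq 1$, its density is \[ D(\mathcal{F}) := \frac{1}{n|\mathcal{F}|} \sum_{A \in \mathcal{F}} |A| = \frac{1}{n|\mathcal{F}|}\sum_{a \in \bigcup\mathcal{F}} |\mathcal{F}_a|, \] and $s_n$ denotes the minimum of $D(\mathcal{F})$ over all union-closed families $\mathcal{F}$ with $|\bigcup\mathcal{F}| = n$. *)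

theory Defs
  imports Complex_Main
begin

definition union_closed_family :: "'a set set \<Rightarrow> bool" where
  "union_closed_family F \<longleftrightarrow>
     finite F \<and> (\<forall>A\<in>F. finite A) \<and> (\<forall>A\<in>F. \<forall>B\<in>F. A \<union> B \<in> F)"

definition members_containing :: "'a set set \<Rightarrow> 'a \<Rightarrow> 'a set set" where
  "members_containing F a = {S \<in> F. a \<in> S}"

definition family_density :: "'a set set \<Rightarrow> real" where
  "family_density F = 1 / (real (card (\<Union>F)) * real (card F)) * (\<Sum>A\<in>F. real (card A))"

(* Union-closed families are considered up to renaming of the elements, so it suffices to let the
   ground sets be sets of natural numbers; densities_invariant below confirms that a family over
   any other type contributes no further value. *)
definition densities :: "nat \<Rightarrow> real set" where
  "densities n = {family_density F | F :: nat set set. union_closed_family F \<and> card (\<Union>F) = n}"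

(* Min is only meaningful on finite nonempty sets: see finite_densities and densities_nonempty. *)
definition min_density :: "nat \<Rightarrow> real" where
  "min_density n = Min (densities n)"

lemma family_density_eq_sum_members_containing:
  assumes "union_closed_family F"
  shows "family_density F = 1 / (real (card (\<Union>F)) * real (card F)) *
           (\<Sum>a\<in>\<Union>F. real (card (members_containing F a)))"
proof -
  have fin: "finite F" "finite (\<Union>F)"
    using assms by (auto simp: union_closed_family_def)
  have "(\<Sum>A\<in>F. card A) = (\<Sum>A\<in>F. card {a \<in> \<Union>F. a \<in> A})"
    by (rule sum.cong[OF refl], rule arg_cong[where f = card]) auto
  also have "\<dots> = (\<Sum>a\<in>\<Union>F. card {A \<in> F. a \<in> A})"
    using sum.swap_restrict[OF fin, of "\<lambda>_ _. 1::nat" "\<lambda>A a. a \<in> A"] by simp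
  finally have "(\<Sum>A\<in>F. card A) = (\<Sum>a\<in>\<Union>F. card (members_containing F a))"
    by (simp add: members_containing_def)
  then have "(\<Sum>A\<in>F. real (card A)) = (\<Sum>a\<in>\<Union>F. real (card (members_containing F a)))"
    by (metis of_nat_sum)
  then show ?thesis by (simp add: family_density_def)
qed

lemma finite_densities: "finite (densities n)"
proof -
  let ?g = "\<lambda>(k, m). 1 / (real n * real m) * real k"
  have "densities n \<subseteq> ?g ` ({..2 ^ n * n} \<times> {..2 ^ n})"
  proof
    fix x assume "x \<in> densities n"
    then obtain F :: "nat set set" where F: "union_closed_family F" "card (\<Union>F) = n"
      and x: "x = family_density F" by (auto simp: densities_def)
    have fin: "finite F" "finite (\<Union>F)"
      using F by (auto simp: union_closed_family_def)
    have "card F \<le> card (Pow (\<Union>F))"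
      by (rule card_mono) (use fin in auto)
    then have m: "card F \<le> 2 ^ n" using F fin by (simp add: card_Pow)
    have "card A \<le> n" if "A \<in> F" for A
      using card_mono[OF fin(2), of A] that F by auto
    then have "(\<Sum>A\<in>F. card A) \<le> card F * n"
      using sum_bounded_above[of F card n] by simp
    also have "\<dots> \<le> 2 ^ n * n" using m by simp
    finally have k: "(\<Sum>A\<in>F. card A) \<le> 2 ^ n * n" .
    have "x = ?g (\<Sum>A\<in>F. card A, card F)"
      by (simp add: x family_density_def F)
    then show "x \<in> ?g ` ({..2 ^ n * n} \<times> {..2 ^ n})" using k m by blast
  qed
  then show ?thesis by (rule finite_subset) simp
qed

lemma densities_nonempty: "densities n \<noteq> {}"
proof -
  have "union_closed_family {{..<n}}" "card (\<Union>{{..<n}}) = n"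
    by (auto simp: union_closed_family_def)
  then show ?thesis unfolding densities_def by blast
qed

lemma densities_invariant:
  fixes F :: "'a set set"
  assumes "union_closed_family F" "card (\<Union>F) = n"
  shows "family_density F \<in> densities n"
proof -
  have fin: "finite F" "finite (\<Union>F)"
    using assms by (auto simp: union_closed_family_def)
  obtain f :: "'a \<Rightarrow> nat" where f: "inj_on f (\<Union>F)"
    using finite_imp_inj_to_nat_seg[OF fin(2)] by blast
  let ?G = "(\<lambda>A. f ` A) ` F"
  have U: "\<Union>?G = f ` \<Union>F" by auto
  have cU: "card (\<Union>?G) = card (\<Union>F)" unfolding U by (rule card_image[OF f])
  have inj: "inj_on (\<lambda>A. f ` A) F"
    using f by (auto intro!: inj_onI simp: inj_on_image_eq_iff[OF f] Sup_upper)
  have uc: "union_closed_family ?G"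
    using assms(1) by (auto simp: union_closed_family_def image_Un[symmetric])
  have "(\<Sum>A\<in>?G. real (card A)) = (\<Sum>A\<in>F. real (card (f ` A)))"
    by (simp add: sum.reindex[OF inj])
  also have "\<dots> = (\<Sum>A\<in>F. real (card A))"
    by (rule sum.cong[OF refl]) (metis Sup_upper card_image f inj_on_subset)
  finally have "family_density ?G = family_density F"
    unfolding family_density_def cU card_image[OF inj] by simp
  then show ?thesis
    unfolding densities_def using uc cU assms(2) by (metis (mono_tags, lifting) mem_Collect_eq)
qed

end

theory Submission
  imports Defs
begin

text \<open>
  Reimer's theorem bounds the average member size of a union-closed family F with m members
  from below by (log 2 m) / 2. Pushing the family upwards one element at a time yields an
  injection f onto an up-closed family such that the intervals [A, f A] are pairwise disjoint.
  Disjointness and up-closure together give that the sum of the |A| is at least the sum of the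
  n - |f A|, while counting the subsets covered by the intervals and using convexity shows that
  |A| + n - |f A| is at least log 2 m on average.

  If m \<ge> n this suffices. Otherwise F is already separated by at most m elements of the ground
  set. Reimer's theorem applies to the trace on these elements, and each of the remaining n - m
  or more elements lies in some member, so the total size is at least
  m (log 2 m) / 2 + n - m \<ge> m (log 2 n) / 2.
\<close>

section \<open>Pushing a union-closed family upwards\<close>

text \<open>A member whose enlargement is already present stays put, so distinct members never
  collide.\<close>

definition push_up :: "'a \<Rightarrow> 'a set set \<Rightarrow> 'a set \<Rightarrow> 'a set" where
  "push_up i F A = (if insert i A \<in> F then A else insert i A)"

lemma push_up_image: "push_up i F ` F = insert i ` F \<union> {A \<in> F. insert i A \<in> F}"
proof -
  have "insert i A \<in> push_up i F ` F" if "A \<in> F" for A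
    using that by (cases "insert i A \<in> F") (force simp: push_up_def)+
  moreover have "A \<in> push_up i F ` F" if "A \<in> F" "insert i A \<in> F" for A
    using that by (force simp: push_up_def)
  ultimately show ?thesis by (auto simp: push_up_def)
qed

text \<open>Only a union that stays \<open>A \<union> B\<close> needs care: its enlargement must lie
  in \<open>F\<close>. It does, being the union of \<open>insert i A\<close> and
  \<open>B\<close>.\<close>

lemma push_up_image_union_closed:
  assumes "\<forall>A\<in>F. \<forall>B\<in>F. A \<union> B \<in> F"
  shows "\<forall>A\<in>push_up i F ` F. \<forall>B\<in>push_up i F ` F. A \<union> B \<in> push_up i F ` F"
proof (intro ballI)
  fix X Y assume "X \<in> push_up i F ` F" "Y \<in> push_up i F ` F"
  then obtain A B where AB: "A \<in> F" "B \<in> F"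
    and X: "X = insert i A \<or> X = A \<and> insert i A \<in> F"
    and Y: "Y = insert i B \<or> Y = B \<and> insert i B \<in> F"
    unfolding push_up_image by blast
  have AB': "A \<union> B \<in> F" using assms AB by blast
  have "X \<union> Y = insert i (A \<union> B) \<or> X \<union> Y = A \<union> B \<and> insert i A \<in> F"
    using X Y by auto
  moreover have "insert i (A \<union> B) \<in> F" if "insert i A \<in> F"
    using assms that AB by (metis Un_insert_left)
  ultimately show "X \<union> Y \<in> push_up i F ` F"
    unfolding push_up_image using AB' by auto
qed

text \<open>Carries the premise \<open>A \<union> C \<in> F\<close> of the interval condition over
  to the pushed family, where the induction hypothesis below needs it.\<close>

lemma push_up_Un_mem:
  assumes uc: "\<forall>A\<in>F. \<forall>B\<in>F. A \<union> B \<in> F" and "A \<in> F" and C: "A \<union> C \<in> F"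
  shows "push_up i F A \<union> C \<in> push_up i F ` F"
proof (cases "insert i A \<in> F")
  case True
  then have "insert i A \<union> (A \<union> C) \<in> F" using uc C by blast
  moreover have "insert i A \<union> (A \<union> C) = insert i (A \<union> C)" by auto
  ultimately show ?thesis using True C unfolding push_up_image by (simp add: push_up_def)
next
  case False
  then show ?thesis using C unfolding push_up_image by (auto simp: push_up_def)
qed

text \<open>The second clause says that \<open>A\<close> is the only member between \<open>A\<close>
  and \<open>f A\<close>, in a form that passes through a push. The last clause is there for the
  induction: closure under \<open>i\<close>, gained by the first push, must survive the later
  ones.\<close>

lemma ex_up_closed_injection:
  assumes "finite I" "\<forall>A\<in>F. \<forall>B\<in>F. A \<union> B \<in> F"
  shows "\<exists>f. (\<forall>A\<in>F. A \<subseteq> f A \<and> f A \<subseteq> A \<union> I) \<and>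
             (\<forall>A\<in>F. \<forall>C. A \<union> C \<in> F \<longrightarrow> C \<subseteq> f A \<longrightarrow> C \<subseteq> A) \<and>
             (\<forall>i\<in>I. \<forall>X\<in>f ` F. insert i X \<in> f ` F) \<and>
             (\<forall>j. (\<forall>X\<in>F. insert j X \<in> F) \<longrightarrow> (\<forall>X\<in>f ` F. insert j X \<in> f ` F))"
  using assms
proof (induction I arbitrary: F rule: finite_induct)
  case empty
  show ?case by (rule exI[of _ id]) auto
next
  case (insert i I)
  let ?p = "push_up i F" and ?G = "push_up i F ` F"
  obtain f where
    sub: "\<forall>A\<in>?G. A \<subseteq> f A \<and> f A \<subseteq> A \<union> I" and
    int: "\<forall>A\<in>?G. \<forall>C. A \<union> C \<in> ?G \<longrightarrow> C \<subseteq> f A \<longrightarrow> C \<subseteq> A" and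
    up: "\<forall>i\<in>I. \<forall>X\<in>f ` ?G. insert i X \<in> f ` ?G" and
    pres: "\<forall>j. (\<forall>X\<in>?G. insert j X \<in> ?G) \<longrightarrow> (\<forall>X\<in>f ` ?G. insert j X \<in> f ` ?G)"
    using insert.IH[OF push_up_image_union_closed[OF insert.prems, of i]]
    by (elim exE conjE) (rule that)
  have p: "A \<subseteq> ?p A" "?p A \<subseteq> insert i A" for A by (auto simp: push_up_def)
  have im: "(f \<circ> ?p) ` F = f ` ?G" by (simp add: image_comp)
  have "A \<subseteq> (f \<circ> ?p) A \<and> (f \<circ> ?p) A \<subseteq> A \<union> insert i I" if "A \<in> F" for A
    using sub p[of A] that by fastforce
  moreover have "C \<subseteq> A" if A: "A \<in> F" and AC: "A \<union> C \<in> F" and C: "C \<subseteq> (f \<circ> ?p) A" for A C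
  proof -
    have "C \<subseteq> ?p A"
      using int push_up_Un_mem[OF insert.prems A AC, of i] A C by auto
    show ?thesis
    proof (cases "i \<in> C \<and> insert i A \<notin> F")
      case True
      \<comment> \<open>Here \<open>A \<union> C\<close> is squeezed onto \<open>insert i A\<close>,
        so its membership in \<open>F\<close> is a contradiction.\<close>
      then have "A \<union> C = insert i A" using \<open>C \<subseteq> ?p A\<close> p(2)[of A] by blast
      then show ?thesis using True AC by simp
    next
      case False
      then show ?thesis using \<open>C \<subseteq> ?p A\<close> by (auto simp: push_up_def split: if_splits)
    qed
  qed
  moreover have "\<forall>X\<in>?G. insert i X \<in> ?G"
    unfolding push_up_image by auto
  then have "\<forall>j\<in>insert i I. \<forall>X\<in>f ` ?G. insert j X \<in> f ` ?G"
    using up pres by blast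
  moreover have "\<forall>X\<in>?G. insert j X \<in> ?G" if "\<forall>X\<in>F. insert j X \<in> F" for j
    using that unfolding push_up_image by (auto simp: insert_commute[of j i])
  then have "\<forall>j. (\<forall>X\<in>F. insert j X \<in> F) \<longrightarrow> (\<forall>X\<in>f ` ?G. insert j X \<in> f ` ?G)"
    using pres by blast
  ultimately show ?case unfolding im[symmetric] by (intro exI[of _ "f \<circ> ?p"]) blast
qed

section \<open>Interval counting and convexity\<close>

lemma card_set_interval:
  assumes "finite B" "A \<subseteq> B"
  shows "card {S. A \<subseteq> S \<and> S \<subseteq> B} = 2 ^ (card B - card A)"
proof -
  have "bij_betw (\<lambda>S. S \<union> A) (Pow (B - A)) {S. A \<subseteq> S \<and> S \<subseteq> B}"
    by (rule bij_betw_byWitness[where f' = "\<lambda>S. S - A"]) (use assms in auto)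
  then have "card {S. A \<subseteq> S \<and> S \<subseteq> B} = card (Pow (B - A))"
    by (metis bij_betw_same_card)
  then show ?thesis
    using assms by (simp add: card_Pow card_Diff_subset finite_subset)
qed

text \<open>Jensen's inequality for the exponential, obtained from the tangent bound
  \<open>1 + x \<le> exp x\<close>.\<close>

lemma sum_le_log_of_sum_powers_le:
  fixes d :: "'b \<Rightarrow> nat"
  assumes "finite F" "F \<noteq> {}" and le: "(\<Sum>A\<in>F. 2 ^ d A) \<le> (2::real) ^ n"
  shows "(\<Sum>A\<in>F. real (d A)) \<le> real (card F) * (real n - log 2 (real (card F)))"
proof -
  let ?m = "real (card F)"
  have m: "?m > 0" using assms by (simp add: card_gt_0_iff)
  \<comment> \<open>\<open>t\<close> is the logarithm of \<open>2 ^ n / ?m\<close>, the largest mean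
    the powers may have. Shifting by it makes the exponentials sum to at most \<open>?m\<close>,
    which cancels the sum of the ones.\<close>
  define t where "t = real n * ln 2 - ln ?m"
  have e: "exp (real (d A) * ln 2 - t) = 2 ^ d A * (?m / 2 ^ n)" for A
    using m by (simp add: t_def exp_diff exp_of_nat_mult)
  have "(\<Sum>A\<in>F. 1 + (real (d A) * ln 2 - t)) \<le> (\<Sum>A\<in>F. exp (real (d A) * ln 2 - t))"
    by (rule sum_mono) (rule exp_ge_add_one_self)
  also have "\<dots> = (\<Sum>A\<in>F. 2 ^ d A) * (?m / 2 ^ n)"
    by (simp only: e sum_distrib_right)
  also have "\<dots> \<le> 2 ^ n * (?m / 2 ^ n)"
    by (rule mult_right_mono[OF le]) simp
  finally have "(\<Sum>A\<in>F. real (d A)) * ln 2 \<le> ?m * t"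
    by (simp add: sum.distrib sum_subtractf sum_distrib_right)
  then show ?thesis
    by (simp add: t_def log_def field_simps)
qed

section \<open>Reimer's theorem\<close>

theorem reimer_average_size:
  assumes F: "union_closed_family F" and ne: "F \<noteq> {}"
  shows "real (card F) * log 2 (real (card F)) / 2 \<le> (\<Sum>A\<in>F. real (card A))"
proof -
  let ?G = "\<Union>F"
  define n where "n = card ?G"
  have fin: "finite F" "finite ?G" and finA: "\<And>A. A \<in> F \<Longrightarrow> finite A"
    and uc: "\<forall>A\<in>F. \<forall>B\<in>F. A \<union> B \<in> F"
    using F by (auto simp: union_closed_family_def)
  obtain f where
    sub: "\<forall>A\<in>F. A \<subseteq> f A \<and> f A \<subseteq> A \<union> ?G" and
    int: "\<forall>A\<in>F. \<forall>C. A \<union> C \<in> F \<longrightarrow> C \<subseteq> f A \<longrightarrow> C \<subseteq> A" and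
    up: "\<forall>i\<in>?G. \<forall>X\<in>f ` F. insert i X \<in> f ` F"
    using ex_up_closed_injection[OF fin(2) uc] by blast
  have fG: "f A \<subseteq> ?G" and Af: "A \<subseteq> f A" if "A \<in> F" for A
    using sub that by blast+
  have disj: "A = B" if "A \<in> F" "B \<in> F" "A \<subseteq> S" "S \<subseteq> f A" "B \<subseteq> S" "S \<subseteq> f B" for A B S
  proof -
    \<comment> \<open>Both sets lie inside \<open>S\<close>, hence inside \<open>f A\<close> and
      \<open>f B\<close>; the interval condition with \<open>C\<close> taken as \<open>B\<close>,
      then as \<open>A\<close>, gives both inclusions.\<close>
    have "A \<union> B \<in> F" "B \<union> A \<in> F" using uc that by auto
    then show ?thesis using int that by (meson subset_antisym subset_trans)
  qed
  have inj: "inj_on f F"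
    using disj Af by (intro inj_onI) (metis subset_refl)
  define g where "g = inv_into F f"
  have g: "g (insert i (f A)) \<in> F" "f (g (insert i (f A))) = insert i (f A)"
    if "A \<in> F" "i \<in> ?G" for A i
    using up that unfolding g_def by (auto intro!: inv_into_into f_inv_into_f)
  \<comment> \<open>An element \<open>i\<close> missing from \<open>f A\<close> is charged to the
    member whose image is \<open>insert i (f A)\<close>; that member turns out to contain
    \<open>i\<close>.\<close>
  have "card (SIGMA A:F. ?G - f A) \<le> card (SIGMA A:F. A)"
  proof (rule card_inj_on_le[where f = "\<lambda>(A, i). (g (insert i (f A)), i)"])
    show "inj_on (\<lambda>(A, i). (g (insert i (f A)), i)) (SIGMA A:F. ?G - f A)"
    proof -
      have "A = B" if A: "A \<in> F" "i \<in> ?G - f A" and B: "B \<in> F" "i \<in> ?G - f B"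
        and eq: "g (insert i (f A)) = g (insert i (f B))" for A B i
      proof -
        have "insert i (f A) = insert i (f B)" using g A B eq by (metis DiffD1)
        then have "f A = f B" using A B by (simp add: insert_ident)
        then show "A = B" using inj A B by (meson inj_onD)
      qed
      then show ?thesis by (fastforce intro: inj_onI)
    qed
    show "(\<lambda>(A, i). (g (insert i (f A)), i)) ` (SIGMA A:F. ?G - f A) \<subseteq> (SIGMA A:F. A)"
    proof -
      have "i \<in> g (insert i (f A))" if A: "A \<in> F" "i \<in> ?G - f A" for A i
      proof (rule ccontr)
        let ?C = "g (insert i (f A))"
        have C: "?C \<in> F" "f ?C = insert i (f A)" using g A by auto
        assume "i \<notin> ?C"
        \<comment> \<open>Without \<open>i\<close>, the set \<open>f A\<close> would lie in the
          intervals of both \<open>A\<close> and \<open>?C\<close>, contradicting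
          disjointness.\<close>
        then have "?C \<subseteq> f A" "f A \<subseteq> f ?C" using Af[OF C(1)] C(2) by auto
        then have "A = ?C" using disj[OF A(1) C(1), of "f A"] Af[OF A(1)] by blast
        then show False using C(2) A by auto
      qed
      then have mem: "(g (insert i (f A)), i) \<in> (SIGMA A:F. A)" if "A \<in> F" "i \<in> ?G - f A" for A i
        using g(1) that by simp
      show ?thesis
        by (rule image_subsetI, elim SigmaE, hypsubst, unfold case_prod_conv) (rule mem)
    qed
    show "finite (SIGMA A:F. A)" using fin finA by auto
  qed
  then have "(\<Sum>A\<in>F. card (?G - f A)) \<le> (\<Sum>A\<in>F. card A)"
    using fin finA by (simp add: card_SigmaI)
  then have "(\<Sum>A\<in>F. real (card (?G - f A))) \<le> (\<Sum>A\<in>F. real (card A))"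
    by (metis of_nat_le_iff of_nat_sum)
  moreover have d1: "real (card (?G - f A)) = real n - real (card (f A))" if "A \<in> F" for A
    using fG[OF that] fin(2) unfolding n_def
    by (simp add: card_Diff_subset finite_subset card_mono of_nat_diff)
  ultimately have codim: "(\<Sum>A\<in>F. real n - real (card (f A))) \<le> (\<Sum>A\<in>F. real (card A))"
    by simp
  let ?d = "\<lambda>A. card (f A) - card A"
  let ?J = "\<lambda>A. {S. A \<subseteq> S \<and> S \<subseteq> f A}"
  have finf: "finite (f A)" if "A \<in> F" for A using fG that fin(2) finite_subset by blast
  have "(\<Sum>A\<in>F. 2 ^ ?d A) = (\<Sum>A\<in>F. card (?J A))"
    by (rule sum.cong[OF refl]) (rule card_set_interval[OF finf Af, symmetric])
  also have "\<dots> = card (\<Union>A\<in>F. ?J A)"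
    by (rule card_UN_disjoint[symmetric]) (use fin finf disj in auto)
  also have "\<dots> \<le> card (Pow ?G)"
  proof (rule card_mono)
    show "(\<Union>A\<in>F. ?J A) \<subseteq> Pow ?G"
    proof (rule UN_least)
      fix A assume "A \<in> F"
      then have "f A \<subseteq> ?G" by (rule fG)
      then show "?J A \<subseteq> Pow ?G" by blast
    qed
  qed (use fin in simp)
  finally have "(\<Sum>A\<in>F. 2 ^ ?d A) \<le> (2::nat) ^ n"
    using fin by (simp add: card_Pow n_def)
  then have "real (\<Sum>A\<in>F. 2 ^ ?d A) \<le> real (2 ^ n)" by (simp only: of_nat_le_iff)
  then have "(\<Sum>A\<in>F. 2 ^ ?d A) \<le> (2::real) ^ n" by simp
  then have "(\<Sum>A\<in>F. real (?d A)) \<le> real (card F) * (real n - log 2 (real (card F)))"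
    by (rule sum_le_log_of_sum_powers_le[OF fin(1) ne])
  moreover have "(\<Sum>A\<in>F. real (?d A)) = (\<Sum>A\<in>F. real (card (f A)) - real (card A))"
    by (rule sum.cong[OF refl]) (use Af finf in \<open>simp add: card_mono of_nat_diff\<close>)
  \<comment> \<open>Adding the two estimates cancels the sizes of the \<open>f A\<close> and bounds
    twice the total size of the members from below.\<close>
  ultimately show ?thesis
    using codim by (simp add: sum_subtractf algebra_simps)
qed

section \<open>Families with fewer members than ground elements\<close>

text \<open>A weak form of Bondy's theorem. By injectivity a new member shares its trace with at
  most one old member, so a single element of their symmetric difference restores
  separation.\<close>

lemma ex_small_separating_set:
  assumes "finite F"
  shows "\<exists>T \<subseteq> \<Union>F. finite T \<and> card T \<le> card F \<and> inj_on (\<lambda>A. A \<inter> T) F"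
  using assms
proof (induction F rule: finite_induct)
  case empty
  show ?case by auto
next
  case (insert A F)
  then obtain T where T: "T \<subseteq> \<Union>F" "finite T" "card T \<le> card F" "inj_on (\<lambda>A. A \<inter> T) F"
    by blast
  show ?case
  proof (cases "\<exists>B\<in>F. B \<inter> T = A \<inter> T")
    case False
    then have "inj_on (\<lambda>A. A \<inter> T) (insert A F)" using T(4) unfolding inj_on_insert by blast
    then show ?thesis using T insert.hyps by (intro exI[of _ T]) auto
  next
    case True
    then obtain B where B: "B \<in> F" "B \<inter> T = A \<inter> T" by blast
    then have "A \<noteq> B" using insert.hyps by auto
    then obtain x where x: "x \<in> A \<union> B" "x \<in> A \<longleftrightarrow> x \<notin> B" by blast
    have sep: "C \<inter> T = D \<inter> T" if "C \<inter> insert x T = D \<inter> insert x T" for C D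
      using that by blast
    have inA: "C \<inter> insert x T \<noteq> A \<inter> insert x T" if C: "C \<in> F" for C
    proof
      assume eq: "C \<inter> insert x T = A \<inter> insert x T"
      then have "C \<inter> T = B \<inter> T" using sep[OF eq] B(2) by simp
      then have "C = B" using inj_onD[OF T(4)] B(1) C by simp
      then show False using eq x by blast
    qed
    have "inj_on (\<lambda>A. A \<inter> insert x T) F"
      by (rule inj_onI) (rule inj_onD[OF T(4) sep])
    then have "inj_on (\<lambda>A. A \<inter> insert x T) (insert A F)"
      using inA unfolding inj_on_insert by blast
    moreover have "card (insert x T) \<le> card (insert A F)"
      using T insert.hyps by (simp add: card_insert_if)
    ultimately show ?thesis using T x B by (intro exI[of _ "insert x T"]) auto
  qed
qed

text \<open>Used with \<open>r\<close> the ratio of ground elements to members, where it pays for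
  replacing \<open>log 2 m\<close> by \<open>log 2 n\<close>.\<close>

lemma half_log2_le:
  assumes "r \<ge> (1::real)"
  shows "log 2 r / 2 \<le> r - 1"
proof -
  \<comment> \<open>The bound \<open>ln x \<le> x - 1\<close> at \<open>x = 1/2\<close> reads
    \<open>- ln 2 \<le> - 1/2\<close>.\<close>
  have "(1/2::real) \<le> ln 2" using ln_le_minus_one[of "1 / 2 :: real"] by (simp add: ln_div)
  moreover have "ln r \<le> r - 1" using assms by (intro ln_le_minus_one) simp
  moreover have "(r - 1) * 1 \<le> (r - 1) * (2 * ln 2)"
    using calculation assms by (intro mult_left_mono) auto
  ultimately show ?thesis by (simp add: log_def field_simps)
qed

lemma sum_card_ge_log_card_Union:
  assumes F: "union_closed_family F" and n: "card (\<Union>F) = n" "n \<ge> 1"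
  shows "real (card F) * log 2 (real n) / 2 \<le> (\<Sum>A\<in>F. real (card A))"
proof -
  have fin: "finite F" "finite (\<Union>F)" and finA: "\<And>A. A \<in> F \<Longrightarrow> finite A" and ne: "F \<noteq> {}"
    using F n by (auto simp: union_closed_family_def)
  let ?m = "real (card F)"
  have m: "?m > 0" using fin ne by (simp add: card_gt_0_iff)
  show ?thesis
  proof (cases "n \<le> card F")
    case True
    then have "log 2 (real n) \<le> log 2 ?m" using n by (subst log_le_cancel_iff) auto
    then have "?m * log 2 (real n) / 2 \<le> ?m * log 2 ?m / 2" using m by simp
    then show ?thesis using reimer_average_size[OF F ne] by linarith
  next
    case False
    obtain T where T: "T \<subseteq> \<Union>F" "finite T" "card T \<le> card F" and inj: "inj_on (\<lambda>A. A \<inter> T) F"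
      using ex_small_separating_set[OF fin(1)] by blast
    let ?H = "(\<lambda>A. A \<inter> T) ` F"
    \<comment> \<open>Intersecting with \<open>T\<close> respects unions, and injectivity keeps the
      number of members.\<close>
    have "union_closed_family ?H"
      using F by (auto simp: union_closed_family_def Int_Un_distrib2[symmetric])
    then have "real (card ?H) * log 2 (real (card ?H)) / 2 \<le> (\<Sum>A\<in>?H. real (card A))"
      using reimer_average_size ne by blast
    then have trace: "?m * log 2 ?m / 2 \<le> (\<Sum>A\<in>F. real (card (A \<inter> T)))"
      by (simp add: card_image[OF inj] sum.reindex[OF inj])
    have "\<Union>F - T = (\<Union>A\<in>F. A - T)" by blast
    then have "card (\<Union>F - T) \<le> (\<Sum>A\<in>F. card (A - T))"
      using card_UN_le[OF fin(1)] by metis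
    then have "n - card F \<le> (\<Sum>A\<in>F. card (A - T))"
      using T n by (simp add: card_Diff_subset)
    then have "real (n - card F) \<le> (\<Sum>A\<in>F. real (card (A - T)))"
      by (metis of_nat_le_iff of_nat_sum)
    \<comment> \<open>The truncated subtraction is genuine here, since \<open>card F < n\<close> in
      this case.\<close>
    then have rest: "real n - ?m \<le> (\<Sum>A\<in>F. real (card (A - T)))"
      using False by (simp add: of_nat_diff)
    have "(\<Sum>A\<in>F. real (card A)) = (\<Sum>A\<in>F. real (card (A \<inter> T)) + real (card (A - T)))"
      by (rule sum.cong[OF refl]) (metis finA card_Int_Diff of_nat_add)
    then have total: "?m * log 2 ?m / 2 + (real n - ?m) \<le> (\<Sum>A\<in>F. real (card A))"
      using trace rest by (simp add: sum.distrib)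
    have "log 2 (real n / ?m) / 2 \<le> real n / ?m - 1"
      using False m by (intro half_log2_le) (simp add: field_simps)
    \<comment> \<open>Scaled by \<open>?m\<close>, the inequality says that the
      \<open>n - ?m\<close> elements outside the trace cover the gap between the two
      logarithms.\<close>
    then have "?m * (log 2 (real n / ?m) / 2) \<le> ?m * (real n / ?m - 1)"
      using m by (intro mult_left_mono) auto
    then have "?m * (log 2 (real n) - log 2 ?m) / 2 \<le> real n - ?m"
      using m n by (simp add: log_divide right_diff_distrib)
    then show ?thesis using total by (simp add: right_diff_distrib diff_divide_distrib)
  qed
qed

lemma family_density_ge:
  assumes F: "union_closed_family F" and n: "card (\<Union>F) = n" "n \<ge> 1"
  shows "family_density F \<ge> log 2 (real n) / (2 * real n)"
proof -
  have "finite F" "F \<noteq> {}" using F n by (auto simp: union_closed_family_def)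
  then have m: "real (card F) > 0" by (simp add: card_gt_0_iff)
  then show ?thesis
    using sum_card_ge_log_card_Union[OF assms] n by (simp add: family_density_def field_simps)
qed

theorem theorem3:
  fixes n :: nat
  assumes "n \<ge> 1"
  shows "(\<forall>F :: 'a set set. union_closed_family F \<and> card (\<Union>F) = n \<longrightarrow>
            family_density F \<ge> log 2 (real n) / (2 * real n))
       \<and> min_density n \<ge> log 2 (real n) / (2 * real n)"
proof
  show "\<forall>F :: 'a set set. union_closed_family F \<and> card (\<Union>F) = n \<longrightarrow>
            family_density F \<ge> log 2 (real n) / (2 * real n)"
    using family_density_ge assms by blast
  \<comment> \<open>The same polymorphic bound is used again, now over the natural numbers.\<close>
  have "\<forall>x\<in>densities n. log 2 (real n) / (2 * real n) \<le> x"
    using family_density_ge assms unfolding densities_def by blast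
  then show "min_density n \<ge> log 2 (real n) / (2 * real n)"
    unfolding min_density_def by (simp add: finite_densities densities_nonempty)
qed

end
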